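(* Let $h:\Psi\to[0,\infty)$ satisfy $\int_\Theta h(\Psi(\theta))\,\Pi(d\theta)<\infty$. If $\Psi$ is countable, then $\psi_{\mathrm{LRSE}}$ is Bayesian unbiased under the loss function $$L(\theta,\psi)=I(\Psi(\theta)\neq\psi)\,h(\Psi(\theta)).$$
   Context: Setting: $\{f_\theta:\theta\in\Theta\}$ is a family of probability densities with respect to a support measure $\mu$ on a sample space $\mathcal X$, with corresponding probability measures $P_\theta$ and expectations $E_\theta$. $\Pi$ is a proper prior (probability measure) on $\Theta$ with density $\pi$ with respect to a support measure $\nu$. Put $m(x)=\int_\Theta \pi(\theta)f_\theta(x)\,\nu(d\theta)$. The posterior $\Pi(\cdot\,|\,x)$ has density $\pi(\theta\,|\,x)=\pi(\theta)f_\theta(x)/m(x)$ with respect to $\nu$ (for $x$ with $0<m(x)<\infty$). A (measurable) map $\Psi:\Theta\to\Psi$ is given; the same symbol $\Psi$ denotes the map and its target space. $\Pi_\Psi$ and $\Pi_\Psi(\cdot\,|\,x)$ are the marginal prior and marginal posterior of $\psi=\Psi(\theta)$; $\Psi$ being countable, $\pi_\Psi$ and $\pi_\Psi(\cdot\,|\,x)$ are their densities with respect to counting measure (probability functions). $I(\cdot)$ is the indicator. The least relative surprise estimator $\psi_{\mathrm{LRSE}}$ is the (measurable) estimator such that, for each $x$, $\psi_{\mathrm{LRSE}}(x)$ maximizes the relative belief ratio $\pi_\Psi(\psi\,|\,x)/\pi_\Psi(\psi)$ over those $\psi\in\Psi$ with $\pi_\Psi(\psi)>0$; such a maximizer is understood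 to exist. A decision function $\delta:\mathcal X\to\Psi$ is Bayesian unbiased with respect to a loss $L:\Theta\times\Psi\to[0,\infty)$ if $$\int_\Theta\int_\Theta E_\theta\bigl(L(\theta',\delta(x))\bigr)\,\Pi(d\theta)\,\Pi(d\theta')\ \geq\ \int_\Theta E_\theta\bigl(L(\theta,\delta(x))\bigr)\,\Pi(d\theta).$$ *)

theory Defs
  imports "HOL-Probability.Probability"
begin

definition sampling_measure :: "'x measure \<Rightarrow> ('t \<Rightarrow> 'x \<Rightarrow> real) \<Rightarrow> 't \<Rightarrow> 'x measure" where
  "sampling_measure \<mu> f \<theta> = density \<mu> (\<lambda>x. ennreal (f \<theta> x))"

definition prior_measure :: "'t measure \<Rightarrow> ('t \<Rightarrow> real) \<Rightarrow> 't measure" where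
  "prior_measure \<nu> p = density \<nu> (\<lambda>\<theta>. ennreal (p \<theta>))"

text \<open>The prior predictive density \<open>m(x)\<close>; it may be infinite on a \<open>\<mu>\<close>-null set.\<close>

definition prior_predictive ::
    "'t measure \<Rightarrow> ('t \<Rightarrow> real) \<Rightarrow> ('t \<Rightarrow> 'x \<Rightarrow> real) \<Rightarrow> 'x \<Rightarrow> ennreal" where
  "prior_predictive \<nu> p f x = (\<integral>\<^sup>+\<theta>. ennreal (p \<theta> * f \<theta> x) \<partial>\<nu>)"

text \<open>Only meaningful (a probability measure) when \<open>0 < m(x) < \<infinity>\<close>.\<close>

definition posterior_measure ::
    "'t measure \<Rightarrow> ('t \<Rightarrow> real) \<Rightarrow> ('t \<Rightarrow> 'x \<Rightarrow> real) \<Rightarrow> 'x \<Rightarrow> 't measure" where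
  "posterior_measure \<nu> p f x =
     density \<nu> (\<lambda>\<theta>. ennreal (p \<theta> * f \<theta> x) / prior_predictive \<nu> p f x)"

text \<open>The probability function on the countable set \<open>S\<close> of the marginal of \<open>Q\<close> under \<open>\<Psi>\<close>.\<close>

definition marginal_prob ::
    "'t measure \<Rightarrow> ('t \<Rightarrow> 'p) \<Rightarrow> 'p set \<Rightarrow> 'p \<Rightarrow> real" where
  "marginal_prob Q \<Psi> S \<psi> = measure (distr Q (count_space S) \<Psi>) {\<psi>}"

definition relative_belief ::
    "'t measure \<Rightarrow> ('t \<Rightarrow> real) \<Rightarrow> ('t \<Rightarrow> 'x \<Rightarrow> real) \<Rightarrow> ('t \<Rightarrow> 'p) \<Rightarrow> 'p set \<Rightarrow> 'x \<Rightarrow> 'p \<Rightarrow> real" where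
  "relative_belief \<nu> p f \<Psi> S x \<psi> =
     marginal_prob (posterior_measure \<nu> p f x) \<Psi> S \<psi> / marginal_prob (prior_measure \<nu> p) \<Psi> S \<psi>"

text \<open>
  The value of the estimator is constrained only at those \<open>x\<close> where the posterior is defined.
  The remaining \<open>x\<close> form a null set of the prior predictive distribution.
\<close>

definition is_LRSE ::
    "'x measure \<Rightarrow> 't measure \<Rightarrow> ('t \<Rightarrow> real) \<Rightarrow> ('t \<Rightarrow> 'x \<Rightarrow> real) \<Rightarrow> ('t \<Rightarrow> 'p) \<Rightarrow> 'p set
      \<Rightarrow> ('x \<Rightarrow> 'p) \<Rightarrow> bool" where
  "is_LRSE \<mu> \<nu> p f \<Psi> S \<delta> \<longleftrightarrow>
     \<delta> \<in> measurable \<mu> (count_space S) \<and>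
     (\<forall>x\<in>space \<mu>. 0 < prior_predictive \<nu> p f x \<and> prior_predictive \<nu> p f x < \<infinity> \<longrightarrow>
        is_arg_max (relative_belief \<nu> p f \<Psi> S x)
          (\<lambda>\<psi>. \<psi> \<in> S \<and> 0 < marginal_prob (prior_measure \<nu> p) \<Psi> S \<psi>) (\<delta> x))"

text \<open>
  \<open>P \<theta>\<close> is the sampling distribution and \<open>Q\<close> the prior. Both sides are integrals of the
  nonnegative loss and are taken in \<open>[0,\<infinity>]\<close>.
\<close>

definition bayesian_unbiased ::
    "('t \<Rightarrow> 'x measure) \<Rightarrow> 't measure \<Rightarrow> ('t \<Rightarrow> 'p \<Rightarrow> real) \<Rightarrow> ('x \<Rightarrow> 'p) \<Rightarrow> bool" where
  "bayesian_unbiased P Q L \<delta> \<longleftrightarrow>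
     (\<integral>\<^sup>+\<theta>'. (\<integral>\<^sup>+\<theta>. (\<integral>\<^sup>+x. ennreal (L \<theta>' (\<delta> x)) \<partial>P \<theta>) \<partial>Q) \<partial>Q)
       \<ge> (\<integral>\<^sup>+\<theta>. (\<integral>\<^sup>+x. ennreal (L \<theta> (\<delta> x)) \<partial>P \<theta>) \<partial>Q)"

end

theory Submission
  imports Defs
begin

text \<open>
  Write \<open>Pr\<close> for the joint law of \<open>(\<theta>, x)\<close> under the prior and the model. The relative belief
  ratio averages to one over the prior of \<open>\<psi>\<close>, so its maximum is at least one: the posterior
  probability of the value chosen by the least relative surprise estimator is never below its prior
  probability (\<open>max_probability_ratio_ge_one\<close>, \<open>relative_belief_maximizer\<close>). Integrating over the
  samples on which the estimate equals \<open>s\<close> shows that truth and estimate agree on \<open>s\<close> at least as often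
  as if they were independent,
    \<open>Pr(\<Psi> = s) Pr(\<delta> = s) \<le> Pr(\<Psi> = s, \<delta> = s)\<close>  (\<open>LRSE_hit_association\<close>),
  and the complementary form of this is
    \<open>Pr(\<Psi> = s, \<delta> \<noteq> s) \<le> Pr(\<Psi> = s) Pr(\<delta> \<noteq> s)\<close>  (\<open>LRSE_miss_association\<close>).

  For the loss \<open>I(\<Psi>(\<theta>) \<noteq> \<psi>) h(\<Psi>(\<theta>))\<close> the Bayes risk is the sum over \<open>s\<close> of
  \<open>h(s) Pr(\<Psi> = s, \<delta> \<noteq> s)\<close>. When the parameter in the loss is drawn independently of the one that
  generates the data, the joint probability becomes the product \<open>Pr(\<Psi> = s) Pr(\<delta> \<noteq> s)\<close>. So the
  unbiasedness inequality holds term by term.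
\<close>

section \<open>Maximal ratio of two discrete probability measures\<close>

text \<open>
  If the maximal ratio \<open>c\<close> were below one, then \<open>N {t} \<le> c M {t}\<close> for all \<open>t\<close> would sum to
  \<open>1 \<le> c < 1\<close>. The maximum only ranges over the atoms of \<open>M\<close>; absolute continuity covers the other
  points, which would otherwise let \<open>N\<close> carry mass invisible to the ratio.
\<close>

lemma max_probability_ratio_ge_one:
  assumes "countable S" "prob_space M" "prob_space N"
    and sets: "sets M = Pow S" "sets N = Pow S"
    and ac: "\<And>t. t \<in> S \<Longrightarrow> measure M {t} = 0 \<Longrightarrow> measure N {t} = 0"
    and max: "is_arg_max (\<lambda>t. measure N {t} / measure M {t}) (\<lambda>t. t \<in> S \<and> 0 < measure M {t}) s"
  shows "measure M {s} \<le> measure N {s}"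
proof -
  interpret M: prob_space M by fact
  interpret N: prob_space N by fact
  define c where "c = measure N {s} / measure M {s}"
  have s: "s \<in> S" "0 < measure M {s}"
    and best: "\<And>t. t \<in> S \<Longrightarrow> 0 < measure M {t} \<Longrightarrow> measure N {t} / measure M {t} \<le> c"
    using max unfolding is_arg_max_def c_def by (auto simp: not_less)
  have "0 \<le> c" by (simp add: c_def)
  have space: "space M = S" "space N = S"
    using sets sets_eq_imp_space_eq[of _ "count_space S"] by auto
  have bound: "emeasure N {t} \<le> ennreal c * emeasure M {t}" if "t \<in> S" for t
  proof -
    have "measure N {t} \<le> c * measure M {t}"
    proof (cases "measure M {t} = 0")
      case False
      then have "0 < measure M {t}" by (simp add: zero_less_measure_iff)
      with best[OF that this] show ?thesis by (simp add: pos_divide_le_eq)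
    qed (use ac that in simp)
    then show ?thesis
      by (simp add: M.emeasure_eq_measure N.emeasure_eq_measure \<open>0 \<le> c\<close> flip: ennreal_mult)
  qed
  have total: "1 = (\<integral>\<^sup>+t. emeasure D {t} \<partial>count_space S)"
    if "prob_space D" "sets D = Pow S" "space D = S" for D
    using prob_space.emeasure_space_1[OF that(1)] that \<open>countable S\<close>
    by (subst emeasure_countable_singleton[symmetric]) auto
  have "1 = (\<integral>\<^sup>+t. emeasure N {t} \<partial>count_space S)"
    using total assms space by blast
  also have "\<dots> \<le> (\<integral>\<^sup>+t. ennreal c * emeasure M {t} \<partial>count_space S)"
    by (intro nn_integral_mono) (auto intro: bound)
  also have "\<dots> = ennreal c"
    using total[of M] assms space by (simp add: nn_integral_cmult)
  finally have "1 \<le> c" using \<open>0 \<le> c\<close> by simp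
  then show ?thesis using s by (simp add: c_def pos_le_divide_eq)
qed

section \<open>Prior predictive and posterior distributions\<close>

text \<open>
  The base measure \<open>\<nu>\<close> may fail to be sigma-finite, so integrals are exchanged on the product of
  \<open>\<mu>\<close> with the prior \<open>Q\<close>, a probability measure, and densities with respect to \<open>\<nu>\<close> are
  rewritten as integrals over \<open>Q\<close>.
\<close>

locale bayes_model = sigma_finite_measure \<mu>
  for \<mu> :: "'x measure" and \<nu> :: "'t measure"
    and f :: "'t \<Rightarrow> 'x \<Rightarrow> real" and p :: "'t \<Rightarrow> real" +
  assumes f_meas: "(\<lambda>(\<theta>, x). f \<theta> x) \<in> borel_measurable (\<nu> \<Otimes>\<^sub>M \<mu>)"
    and f_nonneg: "\<And>\<theta> x. \<theta> \<in> space \<nu> \<Longrightarrow> x \<in> space \<mu> \<Longrightarrow> 0 \<le> f \<theta> x"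
    and sampling_prob: "\<And>\<theta>. \<theta> \<in> space \<nu> \<Longrightarrow> prob_space (sampling_measure \<mu> f \<theta>)"
    and p_meas: "p \<in> borel_measurable \<nu>"
    and p_nonneg: "\<And>\<theta>. \<theta> \<in> space \<nu> \<Longrightarrow> 0 \<le> p \<theta>"
    and prior_prob: "prob_space (prior_measure \<nu> p)"
begin

abbreviation Q where "Q \<equiv> prior_measure \<nu> p"
abbreviation P where "P \<equiv> sampling_measure \<mu> f"
abbreviation m where "m \<equiv> prior_predictive \<nu> p f"

sublocale prior: prob_space Q by (rule prior_prob)
sublocale pair_sigma_finite Q \<mu> ..

lemma sets_prior [measurable_cong, simp]: "sets Q = sets \<nu>"
  and space_prior [simp]: "space Q = space \<nu>"
  by (simp_all add: prior_measure_def)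

lemma sets_sampling [measurable_cong, simp]: "sets (P \<theta>) = sets \<mu>"
  and space_sampling [simp]: "space (P \<theta>) = space \<mu>"
  by (simp_all add: sampling_measure_def)

declare p_meas [measurable]

lemma f_measurable_pair [measurable]: "(\<lambda>z. f (fst z) (snd z)) \<in> borel_measurable (\<nu> \<Otimes>\<^sub>M \<mu>)"
  using f_meas by (simp add: case_prod_beta)

lemma f_measurable_swap [measurable]: "(\<lambda>z. f (snd z) (fst z)) \<in> borel_measurable (\<mu> \<Otimes>\<^sub>M \<nu>)"
  using measurable_compose[OF measurable_pair_swap' f_measurable_pair] by (simp add: case_prod_beta)

lemma f_measurable_parameter [measurable]: "x \<in> space \<mu> \<Longrightarrow> (\<lambda>\<theta>. f \<theta> x) \<in> borel_measurable \<nu>"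
  using measurable_compose[OF measurable_Pair2' f_measurable_pair, of x] by simp

lemma f_measurable_sample [measurable]: "\<theta> \<in> space \<nu> \<Longrightarrow> f \<theta> \<in> borel_measurable \<mu>"
  using measurable_compose[OF measurable_Pair1' f_measurable_pair, of \<theta>] by simp

lemma nn_integral_prior_likelihood:
  assumes [measurable]: "A \<in> sets \<nu>" "x \<in> space \<mu>"
  shows "(\<integral>\<^sup>+\<theta>. ennreal (p \<theta> * f \<theta> x) * indicator A \<theta> \<partial>\<nu>) = (\<integral>\<^sup>+\<theta>. ennreal (f \<theta> x) * indicator A \<theta> \<partial>Q)"
  unfolding prior_measure_def
  by (subst nn_integral_density)
     (auto intro!: nn_integral_cong simp: ennreal_mult p_nonneg f_nonneg assms mult.assoc)

lemma prior_predictive_eq: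
  assumes "x \<in> space \<mu>"
  shows "m x = (\<integral>\<^sup>+\<theta>. ennreal (f \<theta> x) \<partial>Q)"
proof -
  have "m x = (\<integral>\<^sup>+\<theta>. ennreal (p \<theta> * f \<theta> x) * indicator (space \<nu>) \<theta> \<partial>\<nu>)"
    unfolding prior_predictive_def by (auto intro!: nn_integral_cong)
  also have "\<dots> = (\<integral>\<^sup>+\<theta>. ennreal (f \<theta> x) * indicator (space \<nu>) \<theta> \<partial>Q)"
    by (rule nn_integral_prior_likelihood) (use assms in auto)
  also have "\<dots> = (\<integral>\<^sup>+\<theta>. ennreal (f \<theta> x) \<partial>Q)"
    by (auto intro!: nn_integral_cong)
  finally show ?thesis .
qed

text \<open>
  By Tonelli the prior predictive density integrates to one.
\<close>

lemma prior_predictive_AE_finite: "AE x in \<mu>. m x < \<infinity>"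
proof -
  have "(\<integral>\<^sup>+x. (\<integral>\<^sup>+\<theta>. ennreal (f \<theta> x) \<partial>Q) \<partial>\<mu>) = (\<integral>\<^sup>+\<theta>. (\<integral>\<^sup>+x. ennreal (f \<theta> x) \<partial>\<mu>) \<partial>Q)"
    by (rule Fubini') measurable
  also have "\<dots> = (\<integral>\<^sup>+\<theta>. 1 \<partial>Q)"
  proof (rule nn_integral_cong)
    fix \<theta> assume "\<theta> \<in> space Q"
    then have [measurable]: "\<theta> \<in> space \<nu>" by simp
    have "emeasure (P \<theta>) (space \<mu>) = 1"
      using prob_space.emeasure_space_1[OF sampling_prob[of \<theta>]] \<open>\<theta> \<in> space \<nu>\<close> by simp
    then show "(\<integral>\<^sup>+x. ennreal (f \<theta> x) \<partial>\<mu>) = 1"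
      by (simp add: sampling_measure_def emeasure_density cong: nn_integral_cong)
  qed
  also have "\<dots> = 1" by (simp add: prior.emeasure_space_1[simplified])
  finally have "AE x in \<mu>. (\<integral>\<^sup>+\<theta>. ennreal (f \<theta> x) \<partial>Q) \<noteq> \<infinity>"
    by (intro nn_integral_PInf_AE) (simp_all, measurable)
  moreover have "AE x in \<mu>. x \<in> space \<mu>" by simp
  ultimately show ?thesis
    by eventually_elim (simp add: prior_predictive_eq top.not_eq_extremum)
qed

lemma posterior_emeasure:
  assumes [measurable]: "A \<in> sets \<nu>" "x \<in> space \<mu>"
  shows "emeasure (posterior_measure \<nu> p f x) A = (\<integral>\<^sup>+\<theta>. ennreal (f \<theta> x) * indicator A \<theta> \<partial>Q) / m x"
proof -
  have "emeasure (posterior_measure \<nu> p f x) A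
      = (\<integral>\<^sup>+\<theta>. ennreal (p \<theta> * f \<theta> x) * indicator A \<theta> / m x \<partial>\<nu>)"
    unfolding posterior_measure_def
    by (subst emeasure_density) (auto intro!: nn_integral_cong simp: divide_ennreal_def mult_ac)
  also have "\<dots> = (\<integral>\<^sup>+\<theta>. ennreal (p \<theta> * f \<theta> x) * indicator A \<theta> \<partial>\<nu>) / m x"
    by (rule nn_integral_divide) measurable
  finally show ?thesis by (simp add: nn_integral_prior_likelihood assms)
qed

lemma posterior_prob_space:
  assumes "x \<in> space \<mu>" "0 < m x" "m x < \<infinity>"
  shows "prob_space (posterior_measure \<nu> p f x)"
proof
  have "emeasure (posterior_measure \<nu> p f x) (space \<nu>) = m x / m x"
  proof -
    have "(\<integral>\<^sup>+\<theta>. ennreal (f \<theta> x) * indicator (space \<nu>) \<theta> \<partial>Q) = m x"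
      unfolding prior_predictive_eq[OF assms(1)] by (intro nn_integral_cong) simp
    then show ?thesis using posterior_emeasure[OF sets.top assms(1)] by simp
  qed
  then show "emeasure (posterior_measure \<nu> p f x) (space (posterior_measure \<nu> p f x)) = 1"
    using assms by (simp add: posterior_measure_def ennreal_divide_self)
qed

text \<open>
  The maximal relative belief ratio is at least one, so the posterior probability of \<open>E\<close> is at least
  its prior probability. Multiplying by \<open>m x\<close> gives a form without division that can be integrated
  over \<open>x\<close>.
\<close>

lemma relative_belief_maximizer:
  assumes "countable S" and \<Psi>: "\<Psi> \<in> measurable \<nu> (count_space S)"
    and x: "x \<in> space \<mu>"  "0 < m x" "m x < \<infinity>"
    and max: "is_arg_max (relative_belief \<nu> p f \<Psi> S x)
          (\<lambda>\<psi>. \<psi> \<in> S \<and> 0 < marginal_prob Q \<Psi> S \<psi>) s"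
  defines "E \<equiv> \<Psi> -` {s} \<inter> space \<nu>"
  shows "emeasure Q E * m x \<le> (\<integral>\<^sup>+\<theta>. ennreal (f \<theta> x) * indicator E \<theta> \<partial>Q)"
proof -
  define R where "R = posterior_measure \<nu> p f x"
  have [measurable_cong, simp]: "sets R = sets \<nu>" and [simp]: "space R = space \<nu>"
    by (simp_all add: R_def posterior_measure_def)
  interpret R: prob_space R
    unfolding R_def by (rule posterior_prob_space) fact+
  have \<Psi>Q [measurable]: "\<Psi> \<in> measurable Q (count_space S)" "\<Psi> \<in> measurable R (count_space S)"
    using \<Psi> by (simp_all cong: measurable_cong_sets)
  have E_sets: "\<Psi> -` {t} \<inter> space \<nu> \<in> sets \<nu>" if "t \<in> S" for t
    using measurable_sets[OF \<Psi>] that by auto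
  have s: "s \<in> S" using max by (simp add: is_arg_max_def)
  have marg: "measure (distr Q (count_space S) \<Psi>) {t} = measure Q (\<Psi> -` {t} \<inter> space \<nu>)"
      "measure (distr R (count_space S) \<Psi>) {t} = measure R (\<Psi> -` {t} \<inter> space \<nu>)"
    if "t \<in> S" for t
    using that by (simp_all add: measure_distr)
  have "measure (distr Q (count_space S) \<Psi>) {s} \<le> measure (distr R (count_space S) \<Psi>) {s}"
  proof (rule max_probability_ratio_ge_one)
    show "prob_space (distr Q (count_space S) \<Psi>)" "prob_space (distr R (count_space S) \<Psi>)"
      using prior.prob_space_distr R.prob_space_distr \<Psi>Q by blast+
  next
    \<comment> \<open>The posterior has a density with respect to the prior, and so have their marginals.\<close>
    fix t assume t: "t \<in> S" "measure (distr Q (count_space S) \<Psi>) {t} = 0"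
    let ?E = "\<Psi> -` {t} \<inter> space \<nu>"
    have "emeasure Q ?E = 0"
      using t by (simp add: marg prior.emeasure_eq_measure)
    then have "?E \<in> null_sets Q" using E_sets t by auto
    then have "(\<integral>\<^sup>+\<theta>. ennreal (f \<theta> x) * indicator ?E \<theta> \<partial>Q) = 0"
      by (rule nn_integral_null_set)
    then have "emeasure R ?E = 0"
      unfolding R_def using posterior_emeasure[OF E_sets[OF t(1)] x(1)] by simp
    then show "measure (distr R (count_space S) \<Psi>) {t} = 0"
      using t by (simp add: marg R.emeasure_eq_measure)
  qed (use assms in \<open>auto simp: relative_belief_def[abs_def] marginal_prob_def R_def\<close>)
  then have "measure Q E \<le> measure R E"
    using s by (simp add: marg E_def)
  then have "emeasure Q E \<le> emeasure R E"
    by (simp add: prior.emeasure_eq_measure R.emeasure_eq_measure)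
  also have "\<dots> = (\<integral>\<^sup>+\<theta>. ennreal (f \<theta> x) * indicator E \<theta> \<partial>Q) / m x"
    unfolding R_def using posterior_emeasure E_sets[OF s] x by (simp add: E_def)
  finally have "emeasure Q E * m x \<le> (\<integral>\<^sup>+\<theta>. ennreal (f \<theta> x) * indicator E \<theta> \<partial>Q) / m x * m x"
    by (rule mult_right_mono) simp
  also have "\<dots> = (\<integral>\<^sup>+\<theta>. ennreal (f \<theta> x) * indicator E \<theta> \<partial>Q)"
    using x by (subst mult.commute[of _ "m x"], unfold ennreal_times_divide,
      subst mult.commute[of "m x"], intro mult_divide_eq_ennreal) auto
  finally show ?thesis .
qed

section \<open>Dependence between the true value and its estimate\<close>

lemma sampling_emeasure:
  assumes "\<theta> \<in> space \<nu>" "D \<in> sets \<mu>"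
  shows "emeasure (P \<theta>) D = (\<integral>\<^sup>+x. ennreal (f \<theta> x) * indicator D x \<partial>\<mu>)"
  using assms unfolding sampling_measure_def by (subst emeasure_density) auto

lemma sampling_emeasure_measurable [measurable]:
  assumes [measurable]: "D \<in> sets \<mu>"
  shows "(\<lambda>\<theta>. emeasure (P \<theta>) D) \<in> borel_measurable \<nu>"
proof -
  have "(\<lambda>\<theta>. \<integral>\<^sup>+x. ennreal (f \<theta> x) * indicator D x \<partial>\<mu>) \<in> borel_measurable \<nu>"
    by measurable
  then show ?thesis
    by (subst measurable_cong[OF sampling_emeasure]) auto
qed

text \<open>
  Two ways to compute the joint probability of \<open>\<theta> \<in> E\<close> and \<open>x \<in> D\<close>: given the parameter first or
  given the sample first. Risks come in the first form, statements about the posterior in the second.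
\<close>

lemma joint_probability_swap:
  assumes [measurable]: "E \<in> sets \<nu>" "D \<in> sets \<mu>"
  shows "(\<integral>\<^sup>+\<theta>. emeasure (P \<theta>) D * indicator E \<theta> \<partial>Q)
    = (\<integral>\<^sup>+x. (\<integral>\<^sup>+\<theta>. ennreal (f \<theta> x) * indicator E \<theta> \<partial>Q) * indicator D x \<partial>\<mu>)"
proof -
  have "(\<integral>\<^sup>+\<theta>. emeasure (P \<theta>) D * indicator E \<theta> \<partial>Q)
      = (\<integral>\<^sup>+\<theta>. (\<integral>\<^sup>+x. ennreal (f \<theta> x) * indicator E \<theta> * indicator D x \<partial>\<mu>) \<partial>Q)"
    by (intro nn_integral_cong) (auto simp: sampling_emeasure split: split_indicator)
  also have "\<dots> = (\<integral>\<^sup>+x. (\<integral>\<^sup>+\<theta>. ennreal (f \<theta> x) * indicator E \<theta> * indicator D x \<partial>Q) \<partial>\<mu>)"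
    by (rule Fubini'[symmetric]) measurable
  also have "\<dots> = (\<integral>\<^sup>+x. (\<integral>\<^sup>+\<theta>. ennreal (f \<theta> x) * indicator E \<theta> \<partial>Q) * indicator D x \<partial>\<mu>)"
    by (intro nn_integral_cong nn_integral_multc) measurable
  finally show ?thesis .
qed

text \<open>
  Integrating \<open>relative_belief_maximizer\<close> over the samples with \<open>\<delta> x = s\<close> gives
  \<open>Pr(\<Psi> = s) Pr(\<delta> = s) \<le> Pr(\<Psi> = s, \<delta> = s)\<close>. Samples with \<open>m x = 0\<close> contribute nothing to the
  left side, and those with \<open>m x = \<infinity>\<close> form a null set.
\<close>

lemma LRSE_hit_association:
  assumes S: "countable S" and \<Psi> [measurable]: "\<Psi> \<in> measurable \<nu> (count_space S)"
    and LRSE: "is_LRSE \<mu> \<nu> p f \<Psi> S \<delta>" and s: "s \<in> S"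
  defines "E \<equiv> \<Psi> -` {s} \<inter> space \<nu>" and "D \<equiv> \<delta> -` {s} \<inter> space \<mu>"
  shows "emeasure Q E * (\<integral>\<^sup>+\<theta>. emeasure (P \<theta>) D \<partial>Q) \<le> (\<integral>\<^sup>+\<theta>. emeasure (P \<theta>) D * indicator E \<theta> \<partial>Q)"
proof -
  have [measurable]: "\<delta> \<in> measurable \<mu> (count_space S)"
    using LRSE by (simp add: is_LRSE_def)
  have [measurable]: "E \<in> sets \<nu>" "D \<in> sets \<mu>"
    unfolding E_def D_def using s by measurable
  \<comment> \<open>The marginal probability of \<open>D\<close> is the joint one with the whole parameter space.\<close>
  have "(\<integral>\<^sup>+\<theta>. emeasure (P \<theta>) D \<partial>Q) = (\<integral>\<^sup>+\<theta>. emeasure (P \<theta>) D * indicator (space \<nu>) \<theta> \<partial>Q)"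
    by (intro nn_integral_cong) auto
  also have "\<dots> = (\<integral>\<^sup>+x. m x * indicator D x \<partial>\<mu>)"
    by (subst joint_probability_swap)
       (auto intro!: nn_integral_cong arg_cong2[where f = "(*)"] simp: prior_predictive_eq)
  finally have "emeasure Q E * (\<integral>\<^sup>+\<theta>. emeasure (P \<theta>) D \<partial>Q)
      = emeasure Q E * (\<integral>\<^sup>+x. m x * indicator D x \<partial>\<mu>)" by simp
  also have "\<dots> = (\<integral>\<^sup>+x. emeasure Q E * (m x * indicator D x) \<partial>\<mu>)"
  proof (rule nn_integral_cmult[symmetric])
    have "(\<lambda>x. (\<integral>\<^sup>+\<theta>. ennreal (f \<theta> x) \<partial>Q) * indicator D x) \<in> borel_measurable \<mu>"
      by measurable
    then show "(\<lambda>x. m x * indicator D x) \<in> borel_measurable \<mu>"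
      by (simp add: prior_predictive_eq cong: measurable_cong)
  qed
  also have "\<dots> \<le> (\<integral>\<^sup>+x. (\<integral>\<^sup>+\<theta>. ennreal (f \<theta> x) * indicator E \<theta> \<partial>Q) * indicator D x \<partial>\<mu>)"
  proof (rule nn_integral_mono_AE)
    show "AE x in \<mu>. emeasure Q E * (m x * indicator D x)
        \<le> (\<integral>\<^sup>+\<theta>. ennreal (f \<theta> x) * indicator E \<theta> \<partial>Q) * indicator D x"
      using prior_predictive_AE_finite
    proof eventually_elim
      case (elim x)
      show ?case
      proof (cases "x \<in> D \<and> 0 < m x")
        case True
        then have "x \<in> space \<mu>" "\<delta> x = s" by (auto simp: D_def)
        then show ?thesis
          using True elim LRSE relative_belief_maximizer[OF S \<Psi>, of x s]
          by (auto simp: is_LRSE_def E_def)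
      qed (auto simp: not_gr_zero)
    qed
  qed
  also have "\<dots> = (\<integral>\<^sup>+\<theta>. emeasure (P \<theta>) D * indicator E \<theta> \<partial>Q)"
    by (rule joint_probability_swap[symmetric]) measurable
  finally show ?thesis .
qed

text \<open>
  Hits and misses add up to \<open>Pr(\<Psi> = s)\<close> on both sides, so the inequality for hits turns around for
  misses. The cancellation in \<open>[0,\<infinity>]\<close> is sound because the hit term is finite.
\<close>

lemma LRSE_miss_association:
  assumes S: "countable S" and \<Psi> [measurable]: "\<Psi> \<in> measurable \<nu> (count_space S)"
    and LRSE: "is_LRSE \<mu> \<nu> p f \<Psi> S \<delta>" and s: "s \<in> S"
  defines "E \<equiv> \<Psi> -` {s} \<inter> space \<nu>" and "D \<equiv> \<delta> -` {s} \<inter> space \<mu>"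
  shows "(\<integral>\<^sup>+\<theta>. emeasure (P \<theta>) (space \<mu> - D) * indicator E \<theta> \<partial>Q)
    \<le> emeasure Q E * (\<integral>\<^sup>+\<theta>. emeasure (P \<theta>) (space \<mu> - D) \<partial>Q)"
proof -
  have [measurable]: "\<delta> \<in> measurable \<mu> (count_space S)"
    using LRSE by (simp add: is_LRSE_def)
  have [measurable]: "E \<in> sets \<nu>" "D \<in> sets \<mu>"
    unfolding E_def D_def using s by measurable
  have total: "emeasure (P \<theta>) D + emeasure (P \<theta>) (space \<mu> - D) = 1" if "\<theta> \<in> space \<nu>" for \<theta>
  proof -
    interpret prob_space "P \<theta>" using sampling_prob that .
    show ?thesis
      using emeasure_space_1 emeasure_compl[of D "P \<theta>"] emeasure_le_1[of D]
      by (simp add: add_diff_inverse_ennreal)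
  qed
  let ?hE = "\<integral>\<^sup>+\<theta>. emeasure (P \<theta>) D * indicator E \<theta> \<partial>Q"
  let ?mE = "\<integral>\<^sup>+\<theta>. emeasure (P \<theta>) (space \<mu> - D) * indicator E \<theta> \<partial>Q"
  let ?h = "\<integral>\<^sup>+\<theta>. emeasure (P \<theta>) D \<partial>Q"
  let ?m = "\<integral>\<^sup>+\<theta>. emeasure (P \<theta>) (space \<mu> - D) \<partial>Q"
  have "?hE + ?mE = (\<integral>\<^sup>+\<theta>. emeasure (P \<theta>) D * indicator E \<theta>
      + emeasure (P \<theta>) (space \<mu> - D) * indicator E \<theta> \<partial>Q)"
    by (rule nn_integral_add[symmetric]) measurable
  also have "\<dots> = (\<integral>\<^sup>+\<theta>. indicator E \<theta> \<partial>Q)"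
    by (intro nn_integral_cong) (auto simp: total simp flip: distrib_right)
  also have "\<dots> = emeasure Q E" by simp
  finally have E_split: "?hE + ?mE = emeasure Q E" .
  have "?h + ?m = (\<integral>\<^sup>+\<theta>. emeasure (P \<theta>) D + emeasure (P \<theta>) (space \<mu> - D) \<partial>Q)"
    by (rule nn_integral_add[symmetric]) measurable
  also have "\<dots> = (\<integral>\<^sup>+\<theta>. 1 \<partial>Q)" 
    by (intro nn_integral_cong) (auto simp: total)
  also have "\<dots> = 1" by (simp add: prior.emeasure_space_1[simplified])
  finally have split: "?h + ?m = 1" .
  have assoc: "emeasure Q E * ?h \<le> ?hE"
    unfolding E_def D_def by (rule LRSE_hit_association[OF S \<Psi> LRSE s])
  have "emeasure Q E * ?h \<le> emeasure Q E"
    using assoc by (rule order_trans) (simp flip: E_split)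
  then have "emeasure Q E * ?h \<noteq> \<top>"
    by (auto simp: top_unique)
  moreover have "emeasure Q E * ?h + ?mE \<le> emeasure Q E * ?h + emeasure Q E * ?m"
    using add_right_mono[OF assoc, of ?mE] by (simp add: E_split split flip: distrib_left)
  ultimately show ?thesis
    by (simp add: ennreal_add_left_cancel_le)
qed

text \<open>
  Splitting by the countably many values of \<open>\<Psi>\<close> freezes the value inside \<open>g\<close>. This lets both risks
  be compared value by value and requires measurability of \<open>g s\<close> only for fixed \<open>s\<close>.
\<close>

lemma nn_integral_prior_by_value:
  assumes S: "countable S" and \<Psi> [measurable]: "\<Psi> \<in> measurable \<nu> (count_space S)"
    and g: "\<And>s. s \<in> S \<Longrightarrow> g s \<in> borel_measurable \<nu>"
  shows "(\<integral>\<^sup>+\<theta>. g (\<Psi> \<theta>) \<theta> \<partial>Q)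
    = (\<integral>\<^sup>+s. (\<integral>\<^sup>+\<theta>. g s \<theta> * indicator (\<Psi> -` {s} \<inter> space \<nu>) \<theta> \<partial>Q) \<partial>count_space S)"
proof -
  have "(\<integral>\<^sup>+\<theta>. g (\<Psi> \<theta>) \<theta> \<partial>Q)
      = (\<integral>\<^sup>+\<theta>. (\<integral>\<^sup>+s. g s \<theta> * indicator (\<Psi> -` {s} \<inter> space \<nu>) \<theta> \<partial>count_space S) \<partial>Q)"
  proof (rule nn_integral_cong)
    fix \<theta> assume "\<theta> \<in> space Q"
    then have \<theta>: "\<theta> \<in> space \<nu>" "\<Psi> \<theta> \<in> S" using measurable_space[OF \<Psi>] by auto
    have "(\<integral>\<^sup>+s. g s \<theta> * indicator (\<Psi> -` {s} \<inter> space \<nu>) \<theta> \<partial>count_space S)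
        = (\<integral>\<^sup>+s. g (\<Psi> \<theta>) \<theta> * indicator {\<Psi> \<theta>} s \<partial>count_space S)"
      by (intro nn_integral_cong) (auto simp: \<theta> split: split_indicator)
    then show "g (\<Psi> \<theta>) \<theta> = (\<integral>\<^sup>+s. g s \<theta> * indicator (\<Psi> -` {s} \<inter> space \<nu>) \<theta> \<partial>count_space S)"
      using \<theta> by (simp add: nn_integral_cmult)
  qed
  also have "\<dots> = (\<integral>\<^sup>+s. (\<integral>\<^sup>+\<theta>. g s \<theta> * indicator (\<Psi> -` {s} \<inter> space \<nu>) \<theta> \<partial>Q) \<partial>count_space S)"
  proof (rule nn_integral_count_space_nn_integral[OF S])
    fix s assume s: "s \<in> S"
    have [measurable]: "\<Psi> -` {s} \<inter> space \<nu> \<in> sets \<nu>"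
      using measurable_sets[OF \<Psi>] s by auto
    note g[OF s, measurable]
    show "(\<lambda>\<theta>. g s \<theta> * indicator (\<Psi> -` {s} \<inter> space \<nu>) \<theta>) \<in> borel_measurable Q"
      by measurable
  qed
  finally show ?thesis .
qed

end

section \<open>Bayesian unbiasedness\<close>

text \<open>
  The weight \<open>h s\<close> is constant on each level set of \<open>\<Psi>\<close>, so the comparison of misses applies on each
  level set and is summed over the values.
\<close>

theorem theorem4:
  fixes \<mu> :: "'x measure" and \<nu> :: "'t measure"
    and f :: "'t \<Rightarrow> 'x \<Rightarrow> real" and p :: "'t \<Rightarrow> real"
    and \<Psi> :: "'t \<Rightarrow> 'p" and S :: "'p set"
    and h :: "'p \<Rightarrow> real" and \<delta> :: "'x \<Rightarrow> 'p"
  assumes "sigma_finite_measure \<mu>"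
    and "(\<lambda>(\<theta>, x). f \<theta> x) \<in> borel_measurable (\<nu> \<Otimes>\<^sub>M \<mu>)"
    and "\<And>\<theta> x. \<theta> \<in> space \<nu> \<Longrightarrow> x \<in> space \<mu> \<Longrightarrow> 0 \<le> f \<theta> x"
    and "\<And>\<theta>. \<theta> \<in> space \<nu> \<Longrightarrow> prob_space (sampling_measure \<mu> f \<theta>)"
    and "p \<in> borel_measurable \<nu>"
    and "\<And>\<theta>. \<theta> \<in> space \<nu> \<Longrightarrow> 0 \<le> p \<theta>"
    and "prob_space (prior_measure \<nu> p)"
    and "countable S"
    and "\<Psi> \<in> measurable \<nu> (count_space S)"
    and "\<And>\<psi>. \<psi> \<in> S \<Longrightarrow> 0 \<le> h \<psi>"
    and "integrable (prior_measure \<nu> p) (\<lambda>\<theta>. h (\<Psi> \<theta>))"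
    and "is_LRSE \<mu> \<nu> p f \<Psi> S \<delta>"
  shows "bayesian_unbiased (sampling_measure \<mu> f) (prior_measure \<nu> p)
           (\<lambda>\<theta> \<psi>. of_bool (\<Psi> \<theta> \<noteq> \<psi>) * h (\<Psi> \<theta>)) \<delta>"
proof -
  interpret bayes_model \<mu> \<nu> f p
    using assms(1-7) by (simp add: bayes_model_def bayes_model_axioms_def)
  note \<Psi> [measurable] = assms(9)
  have \<delta> [measurable]: "\<delta> \<in> measurable \<mu> (count_space S)"
    using assms(12) by (simp add: is_LRSE_def)
  define miss where "miss s \<theta> = emeasure (P \<theta>) (space \<mu> - \<delta> -` {s} \<inter> space \<mu>)" for s \<theta>
  have \<delta>_sets [measurable]: "\<delta> -` {s} \<inter> space \<mu> \<in> sets \<mu>" if "s \<in> S" for s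
    using measurable_sets[OF \<delta>] that by auto
  have miss_meas: "miss s \<in> borel_measurable \<nu>" if "s \<in> S" for s
    unfolding miss_def using \<delta>_sets[OF that] by measurable
  have loss: "(\<integral>\<^sup>+x. ennreal (of_bool (\<Psi> \<theta>' \<noteq> \<delta> x) * h (\<Psi> \<theta>')) \<partial>P \<theta>)
      = ennreal (h (\<Psi> \<theta>')) * miss (\<Psi> \<theta>') \<theta>" if "\<theta>' \<in> space \<nu>" for \<theta> \<theta>'
  proof -
    have "\<Psi> \<theta>' \<in> S" using measurable_space[OF \<Psi> that] by simp
    have "(\<integral>\<^sup>+x. ennreal (of_bool (\<Psi> \<theta>' \<noteq> \<delta> x) * h (\<Psi> \<theta>')) \<partial>P \<theta>)
      = (\<integral>\<^sup>+x. ennreal (h (\<Psi> \<theta>')) * indicator (space \<mu> - \<delta> -` {\<Psi> \<theta>'} \<inter> space \<mu>) x \<partial>P \<theta>)"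
      by (intro nn_integral_cong) (auto split: split_indicator)
    also have "\<dots> = ennreal (h (\<Psi> \<theta>')) * miss (\<Psi> \<theta>') \<theta>"
      unfolding miss_def using \<delta>_sets[OF \<open>\<Psi> \<theta>' \<in> S\<close>] by (intro nn_integral_cmult_indicator) auto
    finally show ?thesis .
  qed
  let ?E = "\<lambda>s. \<Psi> -` {s} \<inter> space \<nu>"
  have E_sets: "?E s \<in> sets \<nu>" if "s \<in> S" for s
    using measurable_sets[OF \<Psi>] that by auto
  have "(\<integral>\<^sup>+\<theta>. (\<integral>\<^sup>+x. ennreal (of_bool (\<Psi> \<theta> \<noteq> \<delta> x) * h (\<Psi> \<theta>)) \<partial>P \<theta>) \<partial>Q)
      = (\<integral>\<^sup>+\<theta>. ennreal (h (\<Psi> \<theta>)) * miss (\<Psi> \<theta>) \<theta> \<partial>Q)"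
    by (intro nn_integral_cong loss) simp
  also have "\<dots> = (\<integral>\<^sup>+s. (\<integral>\<^sup>+\<theta>. ennreal (h s) * miss s \<theta> * indicator (?E s) \<theta> \<partial>Q) \<partial>count_space S)"
    using miss_meas by (intro nn_integral_prior_by_value[OF assms(8) \<Psi>]) measurable
  also have "\<dots> \<le> (\<integral>\<^sup>+s. (\<integral>\<^sup>+\<theta>'. ennreal (h s) * (\<integral>\<^sup>+\<theta>. miss s \<theta> \<partial>Q) * indicator (?E s) \<theta>' \<partial>Q) \<partial>count_space S)"
  proof (rule nn_integral_mono)
    fix s assume "s \<in> space (count_space S)"
    then have s: "s \<in> S" by simp
    note [measurable] = miss_meas[OF s] E_sets[OF s]
    have "(\<integral>\<^sup>+\<theta>. ennreal (h s) * miss s \<theta> * indicator (?E s) \<theta> \<partial>Q)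
        = ennreal (h s) * (\<integral>\<^sup>+\<theta>. miss s \<theta> * indicator (?E s) \<theta> \<partial>Q)"
      by (simp add: mult.assoc nn_integral_cmult)
    also have "\<dots> \<le> ennreal (h s) * (emeasure Q (?E s) * (\<integral>\<^sup>+\<theta>. miss s \<theta> \<partial>Q))"
      unfolding miss_def
      by (intro mult_left_mono LRSE_miss_association[OF assms(8) \<Psi> assms(12) s]) simp
    also have "\<dots> = (\<integral>\<^sup>+\<theta>'. ennreal (h s) * (\<integral>\<^sup>+\<theta>. miss s \<theta> \<partial>Q) * indicator (?E s) \<theta>' \<partial>Q)"
      by (subst nn_integral_cmult_indicator) (auto simp: mult_ac)
    finally show "(\<integral>\<^sup>+\<theta>. ennreal (h s) * miss s \<theta> * indicator (?E s) \<theta> \<partial>Q)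
        \<le> (\<integral>\<^sup>+\<theta>'. ennreal (h s) * (\<integral>\<^sup>+\<theta>. miss s \<theta> \<partial>Q) * indicator (?E s) \<theta>' \<partial>Q)" .
  qed
  also have "\<dots> = (\<integral>\<^sup>+\<theta>'. ennreal (h (\<Psi> \<theta>')) * (\<integral>\<^sup>+\<theta>. miss (\<Psi> \<theta>') \<theta> \<partial>Q) \<partial>Q)"
    by (rule nn_integral_prior_by_value[OF assms(8) \<Psi>, symmetric]) measurable
  also have "\<dots> = (\<integral>\<^sup>+\<theta>'. (\<integral>\<^sup>+\<theta>. (\<integral>\<^sup>+x. ennreal (of_bool (\<Psi> \<theta>' \<noteq> \<delta> x) * h (\<Psi> \<theta>')) \<partial>P \<theta>) \<partial>Q) \<partial>Q)"
  proof (rule nn_integral_cong)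
    fix \<theta>' assume "\<theta>' \<in> space Q"
    then have \<theta>': "\<theta>' \<in> space \<nu>" "\<Psi> \<theta>' \<in> S" using measurable_space[OF \<Psi>] by auto
    have "miss (\<Psi> \<theta>') \<in> borel_measurable Q"
      using miss_meas[OF \<theta>'(2)] by measurable
    then show "ennreal (h (\<Psi> \<theta>')) * (\<integral>\<^sup>+\<theta>. miss (\<Psi> \<theta>') \<theta> \<partial>Q)
      = (\<integral>\<^sup>+\<theta>. (\<integral>\<^sup>+x. ennreal (of_bool (\<Psi> \<theta>' \<noteq> \<delta> x) * h (\<Psi> \<theta>')) \<partial>P \<theta>) \<partial>Q)"
      by (simp add: loss[OF \<theta>'(1)] nn_integral_cmult)
  qed
  finally show ?thesis
    unfolding bayesian_unbiased_def .
qed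

end
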